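(* If $L_W$ is a crisp Lawvere Laplacian, then there is an isomorphism of $\mathsf Q$-categories $\mathcal S(L_W)\cong\Gamma_WF$.
   Context: Throughout, $\mathsf Q=(Q,\preceq,\cdot,1)$ is a commutative, unital, semicartesian quantale: $(Q,\preceq)$ is a complete lattice, $\cdot$ is an associative commutative operation with unit $1$ that distributes over arbitrary joins in each variable, and $p\cdot q\preceq p\wedge q$ (so $1=\top$). $[p,q]:=\bigvee\{r: p\cdot r\preceq q\}$. A (small) $\mathsf Q$-category $\mathsf C$ is a set $\mathrm{ob}(\mathsf C)$ with elements $\hom_{\mathsf C}(x,y)\in Q$ such that $\hom_{\mathsf C}(x,x)=1$ and $\hom_{\mathsf C}(x,y)\cdot\hom_{\mathsf C}(y,z)\preceq\hom_{\mathsf C}(x,z)$. A $\mathsf Q$-functor is a function $F$ on objects with $\hom_{\mathsf C}(x,y)\preceq\hom_{\mathsf D}(Fx,Fy)$. $x\preceq_q y$ means $\hom(x,y)\succeq q$; $x\approx_q y$ means $x\preceq_q y$ and $y\preceq_q x$. $Q$ itself is a $\mathsf Q$-category with $\hom(p,q)=[p,q]$. Given a set $\mathsf S$, $S:\mathsf S\to\mathrm{ob}(\mathsf C)$ and $W:\mathsf S\to Q$, the weighted meet $\bigwedge^W S$ is an object (unique up to $\approx_1$) with $\hom_{\mathsf C}(x,\bigwedge^W S)=\bigwedge_{c\in\mathsf S}[W(c),\hom_{\mathsf C}(x,S(c))]$ for all $x$; weighted joins satisfy $\hom_{\mathsf C}(\bigvee^W S,x)=\bigwedge_{c}[W(c),\hom_{\mathsf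 C}(S(c),x)]$. A $\mathsf Q$-category is a complete weighted lattice if it has all weighted meets and joins. $\mathsf Q$-functors $F:\mathsf C\to\mathsf D$, $G:\mathsf D\to\mathsf C$ are $q$-adjoint, $F\dashv_q G$, if $\hom_{\mathsf D}(Fx,y)\approx_q\hom_{\mathsf C}(x,Gy)$ (in $Q$) for all $x,y$. $G=(V,E)$ is a simple undirected graph; $\partial e$ is the set of endpoints of $e$; $N_v$ is the set of neighbors of $v$; $v\triangleleft e$ means $v\in\partial e$. $\underline F$ is a network sheaf and $\overline F$ a network cosheaf of complete weighted lattices agreeing on objects: for each $\sigma\in V\sqcup E$ a complete weighted lattice $F\sigma$, and for each $v\triangleleft e$ (arbitrary) $\mathsf Q$-functors $\underline F_{v\triangleleft e}:Fv\to Fe$ and $\overline F_{e\triangleright v}:Fe\to Fv$. $C^0F=\prod_{v\in V}Fv$ with $\hom_{C^0F}(\vec x,\vec y)=\bigwedge_v\hom_{Fv}(x_v,y_v)$. $W:V\times V\to Q$ is a weighting. The Lawvere Laplacian $L_W:\mathrm{ob}(C^0F)\to\mathrm{ob}(C^0F)$ is $$(L_W\vec x)_v=\bigwedge^{W(v,-)}_{w\in N_v,\ \partial e=\{v,w\}}\overline F_{e\triangleright v}\underline F_{w\triangleleft e}x_w$$ (with any choice of representatives of the weighted meets). $L_W$ is crisp if $\underline F_{v\triangleleft e}\dashv_1\overline F_{e\triangleright v}$ for every $v\triangleleft e$. $\mathcal S(L_W)=\mathcal S_1(L_W)$ is the full $\mathsf Q$-subcategory of $C^0F$ on the objects $\vec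 x$ with $\vec x\preceq_1 L_W\vec x$. $\Gamma_WF$ is the $\mathsf Q$-category of $W$-fuzzy global sections of $\underline F$: its objects are the $\vec x\in C^0F$ such that for every edge $e$ with $\partial e=\{v,w\}$ one has $\underline F_{v\triangleleft e}x_v\preceq_{W(v,w)}\underline F_{w\triangleleft e}x_w$ and $\underline F_{w\triangleleft e}x_w\preceq_{W(w,v)}\underline F_{v\triangleleft e}x_v$, and $\hom_{\Gamma_WF}(\vec x,\vec y)=\hom_{C^0F}(\vec x,\vec y)$. *)

theory Defs
  imports "HOL-Library.FuncSet"
begin

class semicartesian_quantale = complete_lattice + comm_monoid_mult +
  assumes mult_Sup: "p * Sup A = (SUP a\<in>A. p * a)"
    and mult_le_inf: "p * q \<le> inf p q"

lemma one_eq_top: "(1::'q::semicartesian_quantale) = top"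
  using mult_le_inf[of "1::'q" top] by (simp add: top.extremum_unique)

definition residual :: "'q::semicartesian_quantale \<Rightarrow> 'q \<Rightarrow> 'q" where
  "residual p q = Sup {r. p * r \<le> q}"

record ('a, 'q) qcat =
  ob :: "'a set"
  hom :: "'a \<Rightarrow> 'a \<Rightarrow> 'q"

locale qcategory =
  fixes C :: "('a, 'q::semicartesian_quantale) qcat"
  assumes hom_refl: "x \<in> ob C \<Longrightarrow> hom C x x = 1"
    and hom_trans: "\<lbrakk>x \<in> ob C; y \<in> ob C; z \<in> ob C\<rbrakk> \<Longrightarrow> hom C x y * hom C y z \<le> hom C x z"

locale qfunctor = dom: qcategory C + cod: qcategory D
  for C :: "('a, 'q::semicartesian_quantale) qcat" and D :: "('b, 'q) qcat" +
  fixes \<Phi> :: "'a \<Rightarrow> 'b"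
  assumes map_ob: "x \<in> ob C \<Longrightarrow> \<Phi> x \<in> ob D"
    and map_hom: "\<lbrakk>x \<in> ob C; y \<in> ob C\<rbrakk> \<Longrightarrow> hom C x y \<le> hom D (\<Phi> x) (\<Phi> y)"

definition qcat_isomorphic ::
    "('a, 'q::semicartesian_quantale) qcat \<Rightarrow> ('b, 'q) qcat \<Rightarrow> bool" where
  "qcat_isomorphic C D \<longleftrightarrow>
    (\<exists>\<Phi> \<Psi>. qfunctor C D \<Phi> \<and> qfunctor D C \<Psi> \<and>
      (\<forall>x\<in>ob C. \<Psi> (\<Phi> x) = x) \<and> (\<forall>y\<in>ob D. \<Phi> (\<Psi> y) = y))"

definition fuzzy_le :: "('a, 'q::semicartesian_quantale) qcat \<Rightarrow> 'q \<Rightarrow> 'a \<Rightarrow> 'a \<Rightarrow> bool" where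
  "fuzzy_le C q x y \<longleftrightarrow> q \<le> hom C x y"

definition fuzzy_equiv :: "('a, 'q::semicartesian_quantale) qcat \<Rightarrow> 'q \<Rightarrow> 'a \<Rightarrow> 'a \<Rightarrow> bool" where
  "fuzzy_equiv C q x y \<longleftrightarrow> fuzzy_le C q x y \<and> fuzzy_le C q y x"

definition quantale_qcat :: "('q::semicartesian_quantale, 'q) qcat" where
  "quantale_qcat = \<lparr>ob = UNIV, hom = residual\<rparr>"

definition q_adjoint ::
    "'q::semicartesian_quantale \<Rightarrow> ('a, 'q) qcat \<Rightarrow> ('b, 'q) qcat \<Rightarrow> ('a \<Rightarrow> 'b) \<Rightarrow> ('b \<Rightarrow> 'a) \<Rightarrow> bool"
  where
  "q_adjoint q C D \<Phi> \<Psi> \<longleftrightarrow> qfunctor C D \<Phi> \<and> qfunctor D C \<Psi> \<and>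
    (\<forall>x\<in>ob C. \<forall>y\<in>ob D. fuzzy_equiv quantale_qcat q (hom D (\<Phi> x) y) (hom C x (\<Psi> y)))"

definition full_sub ::
    "('a, 'q::semicartesian_quantale) qcat \<Rightarrow> ('a \<Rightarrow> bool) \<Rightarrow> ('a, 'q) qcat" where
  "full_sub C P = \<lparr>ob = {x \<in> ob C. P x}, hom = hom C\<rparr>"

definition qprod ::
    "'i set \<Rightarrow> ('i \<Rightarrow> ('a, 'q::semicartesian_quantale) qcat) \<Rightarrow> ('i \<Rightarrow> 'a, 'q) qcat" where
  "qprod I C = \<lparr>ob = (\<Pi>\<^sub>E i\<in>I. ob (C i)), hom = (\<lambda>x y. INF i\<in>I. hom (C i) (x i) (y i))\<rparr>"

definition is_weighted_meet ::
    "('a, 'q::semicartesian_quantale) qcat \<Rightarrow> 'i set \<Rightarrow> ('i \<Rightarrow> 'q) \<Rightarrow> ('i \<Rightarrow> 'a) \<Rightarrow> 'a \<Rightarrow> bool" where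
  "is_weighted_meet C I W S m \<longleftrightarrow> m \<in> ob C \<and>
    (\<forall>x\<in>ob C. hom C x m = (INF c\<in>I. residual (W c) (hom C x (S c))))"

definition is_weighted_join ::
    "('a, 'q::semicartesian_quantale) qcat \<Rightarrow> 'i set \<Rightarrow> ('i \<Rightarrow> 'q) \<Rightarrow> ('i \<Rightarrow> 'a) \<Rightarrow> 'a \<Rightarrow> bool" where
  "is_weighted_join C I W S j \<longleftrightarrow> j \<in> ob C \<and>
    (\<forall>x\<in>ob C. hom C j x = (INF c\<in>I. residual (W c) (hom C (S c) x)))"

text \<open>
  A definition cannot quantify over all index types, so the index sets are taken inside
  \<^typ>\<open>'a \<times> 'q\<close>. This loses nothing: a weighted meet or join depends only on the set of
  pairs \<open>(S c, W c)\<close>. The two lemmas after the locale give meets and joins over any index type.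
\<close>

locale complete_weighted_lattice = qcategory C
  for C :: "('a, 'q::semicartesian_quantale) qcat" +
  assumes ex_weighted_meet: "S \<in> I \<rightarrow> ob C \<Longrightarrow> \<exists>m. is_weighted_meet C (I :: ('a \<times> 'q) set) W S m"
    and ex_weighted_join: "S \<in> I \<rightarrow> ob C \<Longrightarrow> \<exists>j. is_weighted_join C (I :: ('a \<times> 'q) set) W S j"

lemma (in complete_weighted_lattice) ex_weighted_meet_any:
  fixes I :: "'i set"
  assumes "S \<in> I \<rightarrow> ob C"
  shows "\<exists>m. is_weighted_meet C I W S m"
proof -
  have "fst \<in> (\<lambda>c. (S c, W c)) ` I \<rightarrow> ob C"
    using assms by auto
  from ex_weighted_meet[OF this, of snd] show ?thesis
    by (simp add: is_weighted_meet_def image_image)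
qed

lemma (in complete_weighted_lattice) ex_weighted_join_any:
  fixes I :: "'i set"
  assumes "S \<in> I \<rightarrow> ob C"
  shows "\<exists>j. is_weighted_join C I W S j"
proof -
  have "fst \<in> (\<lambda>c. (S c, W c)) ` I \<rightarrow> ob C"
    using assms by auto
  from ex_weighted_join[OF this, of snd] show ?thesis
    by (simp add: is_weighted_join_def image_image)
qed

text \<open>An edge is its own set of endpoints, so \<open>v \<triangleleft> e\<close> is \<open>v \<in> e\<close>.\<close>

locale simple_graph =
  fixes V :: "'v set" and E :: "'v set set"
  assumes edges: "e \<in> E \<Longrightarrow> e \<subseteq> V \<and> card e = 2"

definition neighbors :: "'v set set \<Rightarrow> 'v \<Rightarrow> 'v set" where
  "neighbors E v = {w. {v, w} \<in> E}"

text \<open>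
  The stalks are \<open>F (Inl v)\<close> for vertices and \<open>F (Inr e)\<close> for edges. A sheaf and a cosheaf
  agree on objects when they share \<open>F\<close>. The maps are \<open>res v e\<close> from \<open>F v\<close> to \<open>F e\<close> and
  \<open>ext e v\<close> from \<open>F e\<close> to \<open>F v\<close>.
\<close>

locale network_stalks = simple_graph V E
  for V :: "'v set" and E :: "'v set set" +
  fixes F :: "'v + 'v set \<Rightarrow> ('a, 'q::semicartesian_quantale) qcat"
  assumes stalk: "\<sigma> \<in> V <+> E \<Longrightarrow> complete_weighted_lattice (F \<sigma>)"

locale network_sheaf = network_stalks V E F
  for V :: "'v set" and E :: "'v set set"
    and F :: "'v + 'v set \<Rightarrow> ('a, 'q::semicartesian_quantale) qcat" +
  fixes res :: "'v \<Rightarrow> 'v set \<Rightarrow> 'a \<Rightarrow> 'a"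
  assumes res_functor: "\<lbrakk>e \<in> E; v \<in> e\<rbrakk> \<Longrightarrow> qfunctor (F (Inl v)) (F (Inr e)) (res v e)"

locale network_cosheaf = network_stalks V E F
  for V :: "'v set" and E :: "'v set set"
    and F :: "'v + 'v set \<Rightarrow> ('a, 'q::semicartesian_quantale) qcat" +
  fixes ext :: "'v set \<Rightarrow> 'v \<Rightarrow> 'a \<Rightarrow> 'a"
  assumes ext_functor: "\<lbrakk>e \<in> E; v \<in> e\<rbrakk> \<Longrightarrow> qfunctor (F (Inr e)) (F (Inl v)) (ext e v)"

definition cochains0 ::
    "'v set \<Rightarrow> ('v + 'v set \<Rightarrow> ('a, 'q::semicartesian_quantale) qcat) \<Rightarrow> ('v \<Rightarrow> 'a, 'q) qcat" where
  "cochains0 V F = qprod V (\<lambda>v. F (Inl v))"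

text \<open>
  Weighted meets are unique only up to \<open>\<approx>\<^sub>1\<close>, so the Laplacian is a predicate: it holds of
  every \<open>L\<close> that arises from some choice of representatives.
\<close>

definition is_lawvere_laplacian ::
    "'v set \<Rightarrow> 'v set set \<Rightarrow> ('v + 'v set \<Rightarrow> ('a, 'q::semicartesian_quantale) qcat) \<Rightarrow>
     ('v \<Rightarrow> 'v set \<Rightarrow> 'a \<Rightarrow> 'a) \<Rightarrow> ('v set \<Rightarrow> 'v \<Rightarrow> 'a \<Rightarrow> 'a) \<Rightarrow> ('v \<Rightarrow> 'v \<Rightarrow> 'q) \<Rightarrow>
     (('v \<Rightarrow> 'a) \<Rightarrow> 'v \<Rightarrow> 'a) \<Rightarrow> bool" where
  "is_lawvere_laplacian V E F res ext W L \<longleftrightarrow>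
    (\<forall>x\<in>ob (cochains0 V F). L x \<in> ob (cochains0 V F) \<and>
      (\<forall>v\<in>V. is_weighted_meet (F (Inl v)) (neighbors E v) (W v)
        (\<lambda>w. ext {v, w} v (res w {v, w} (x w))) (L x v)))"

definition crisp ::
    "'v set set \<Rightarrow> ('v + 'v set \<Rightarrow> ('a, 'q::semicartesian_quantale) qcat) \<Rightarrow>
     ('v \<Rightarrow> 'v set \<Rightarrow> 'a \<Rightarrow> 'a) \<Rightarrow> ('v set \<Rightarrow> 'v \<Rightarrow> 'a \<Rightarrow> 'a) \<Rightarrow> bool" where
  "crisp E F res ext \<longleftrightarrow>
    (\<forall>e\<in>E. \<forall>v\<in>e. q_adjoint 1 (F (Inl v)) (F (Inr e)) (res v e) (ext e v))"

definition suffix_points ::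
    "('b, 'q::semicartesian_quantale) qcat \<Rightarrow> 'q \<Rightarrow> ('b \<Rightarrow> 'b) \<Rightarrow> ('b, 'q) qcat" where
  "suffix_points C q L = full_sub C (\<lambda>x. fuzzy_le C q x (L x))"

definition fuzzy_global_sections ::
    "'v set \<Rightarrow> 'v set set \<Rightarrow> ('v + 'v set \<Rightarrow> ('a, 'q::semicartesian_quantale) qcat) \<Rightarrow>
     ('v \<Rightarrow> 'v set \<Rightarrow> 'a \<Rightarrow> 'a) \<Rightarrow> ('v \<Rightarrow> 'v \<Rightarrow> 'q) \<Rightarrow> ('v \<Rightarrow> 'a, 'q) qcat" where
  "fuzzy_global_sections V E F res W = full_sub (cochains0 V F) (\<lambda>x.
    \<forall>e\<in>E. \<forall>v w. e = {v, w} \<longrightarrow>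
      fuzzy_le (F (Inr e)) (W v w) (res v e (x v)) (res w e (x w)) \<and>
      fuzzy_le (F (Inr e)) (W w v) (res w e (x w)) (res v e (x v)))"

end

theory Submission imports Defs begin

text \<open>
  Both categories are full subcategories of the zero-cochains, so it suffices to compare objects.
  By the universal property of the weighted meet, \<open>x \<preceq>\<^sub>1 L x\<close> says that
  \<open>W v w\<close> lies below the hom from \<open>x v\<close> to the image of \<open>x w\<close> in the stalk at \<open>v\<close>, for all
  neighbours \<open>v\<close>, \<open>w\<close>; the crisp adjunction turns this into the hom between the two restrictions
  to the edge, which is the defining inequality of a fuzzy global section.
\<close>

text \<open>Distributivity over the two-element join of \<open>{a, b}\<close>, which equals
  \<open>b\<close> when \<open>a \<le> b\<close>.\<close>

lemma mult_left_mono_quantale: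
  fixes p :: "'q::semicartesian_quantale"
  assumes "a \<le> b"
  shows "p * a \<le> p * b"
proof -
  have "p * a \<le> (SUP c\<in>{a, b}. p * c)"
    by (simp add: SUP_upper)
  also have "\<dots> = p * Sup {a, b}"
    by (simp only: mult_Sup)
  also have "Sup {a, b} = b"
    using assms by (simp add: sup_absorb2)
  finally show ?thesis .
qed

lemma mult_mono_quantale:
  fixes a :: "'q::semicartesian_quantale"
  assumes "a \<le> b" "c \<le> d"
  shows "a * c \<le> b * d"
  using mult_left_mono_quantale[OF assms(2), of a] mult_left_mono_quantale[OF assms(1), of d]
  by (simp add: mult.commute order_trans)

text \<open>Since multiplication distributes over joins, the join defining
  \<open>residual p q\<close> itself satisfies the inequality whose solutions it collects.\<close>

lemma le_residual_iff: "r \<le> residual p q \<longleftrightarrow> p * r \<le> q"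
proof
  assume "r \<le> residual p q"
  then have "p * r \<le> p * Sup {r. p * r \<le> q}"
    unfolding residual_def by (rule mult_left_mono_quantale)
  also have "\<dots> \<le> q"
    unfolding mult_Sup by (rule SUP_least) simp
  finally show "p * r \<le> q" .
qed (auto simp: residual_def intro: Sup_upper)

text \<open>As 1 is the unit, \<open>1 \<le> residual p q\<close> amounts to
  \<open>p \<le> q\<close>; antisymmetry does the rest. Hence a 1-adjunction is an exact equality of
  homs.\<close>

lemma fuzzy_equiv_one_quantale_iff: "fuzzy_equiv quantale_qcat 1 p q \<longleftrightarrow> p = q"
  by (auto simp: fuzzy_equiv_def fuzzy_le_def quantale_qcat_def le_residual_iff)

lemma q_adjoint_one_hom:
  assumes "q_adjoint 1 C D \<Phi> \<Psi>" "x \<in> ob C" "y \<in> ob D"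
  shows "hom D (\<Phi> x) y = hom C x (\<Psi> y)"
  using assms by (simp add: q_adjoint_def fuzzy_equiv_one_quantale_iff)

lemma weighted_meet_one_le_hom_iff:
  assumes "is_weighted_meet C I W S m" "x \<in> ob C"
  shows "1 \<le> hom C x m \<longleftrightarrow> (\<forall>c\<in>I. W c \<le> hom C x (S c))"
  using assms by (simp add: is_weighted_meet_def le_INF_iff le_residual_iff)

lemma qcategory_qprod:
  assumes "\<And>i. i \<in> I \<Longrightarrow> qcategory (C i)"
  shows "qcategory (qprod I C)"
proof
  fix x assume "x \<in> ob (qprod I C)"
  \<comment> \<open>One inequality is enough because 1 is the top element.\<close>
  then have "1 \<le> hom (qprod I C) x x"
    using assms by (auto simp: qprod_def PiE_iff qcategory.hom_refl intro!: INF_greatest)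
  then show "hom (qprod I C) x x = 1"
    by (simp add: one_eq_top top.extremum_unique)
next
  fix x y z
  assume *: "x \<in> ob (qprod I C)" "y \<in> ob (qprod I C)" "z \<in> ob (qprod I C)"
  show "hom (qprod I C) x y * hom (qprod I C) y z \<le> hom (qprod I C) x z"
    unfolding qprod_def qcat.simps
  proof (rule INF_greatest)
    fix i assume i: "i \<in> I"
    have "(INF i\<in>I. hom (C i) (x i) (y i)) * (INF i\<in>I. hom (C i) (y i) (z i))
        \<le> hom (C i) (x i) (y i) * hom (C i) (y i) (z i)"
      using i by (intro mult_mono_quantale INF_lower)
    also have "\<dots> \<le> hom (C i) (x i) (z i)"
      using * i by (intro qcategory.hom_trans assms) (auto simp: qprod_def)
    finally show "(INF i\<in>I. hom (C i) (x i) (y i)) * (INF i\<in>I. hom (C i) (y i) (z i))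
        \<le> hom (C i) (x i) (z i)" .
  qed
qed

lemma qcategory_full_sub: "qcategory C \<Longrightarrow> qcategory (full_sub C P)"
  unfolding qcategory_def full_sub_def by simp

lemma qcat_isomorphic_refl:
  assumes "qcategory C"
  shows "qcat_isomorphic C C"
proof -
  have "qfunctor C C (\<lambda>x. x)"
    using assms by (simp add: qfunctor_def qfunctor_axioms_def)
  then show ?thesis
    unfolding qcat_isomorphic_def by (intro exI[of _ "\<lambda>x. x"]) simp
qed

lemma full_sub_cong:
  assumes "\<And>x. x \<in> ob C \<Longrightarrow> P x \<longleftrightarrow> Q x"
  shows "full_sub C P = full_sub C Q"
  using assms by (auto simp: full_sub_def)

text \<open>The right-hand side ranges over ordered pairs, so each edge is tested in both
  orientations, with weights \<open>W v w\<close> and \<open>W w v\<close>.\<close>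

lemma crisp_laplacian_suffix_iff:
  assumes "network_sheaf V E F res"
    and lap: "is_lawvere_laplacian V E F res ext W L"
    and crisp: "crisp E F res ext"
    and x: "x \<in> ob (cochains0 V F)"
  shows "fuzzy_le (cochains0 V F) 1 x (L x) \<longleftrightarrow>
    (\<forall>v w. {v, w} \<in> E \<longrightarrow>
      fuzzy_le (F (Inr {v, w})) (W v w) (res v {v, w} (x v)) (res w {v, w} (x w)))"
proof -
  interpret network_sheaf V E F res by fact
  have ob: "x v \<in> ob (F (Inl v))" if "v \<in> V" for v
    using x that by (auto simp: cochains0_def qprod_def)
  have in_V: "v \<in> V" "w \<in> V" if "{v, w} \<in> E" for v w
    using edges[OF that] by auto
  \<comment> \<open>The adjunction at the endpoint \<open>v\<close>, applied to \<open>x v\<close>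
    and the restriction of \<open>x w\<close> to the edge.\<close>
  have adj: "hom (F (Inl v)) (x v) (ext {v, w} v (res w {v, w} (x w))) =
      hom (F (Inr {v, w})) (res v {v, w} (x v)) (res w {v, w} (x w))" if e: "{v, w} \<in> E" for v w
  proof -
    have "q_adjoint 1 (F (Inl v)) (F (Inr {v, w})) (res v {v, w}) (ext {v, w} v)"
      using crisp e by (auto simp: crisp_def)
    moreover have "res w {v, w} (x w) \<in> ob (F (Inr {v, w}))"
      using res_functor[OF e, of w] ob in_V[OF e] by (auto intro: qfunctor.map_ob)
    ultimately show ?thesis
      using ob in_V[OF e] by (simp add: q_adjoint_one_hom)
  qed
  have "fuzzy_le (cochains0 V F) 1 x (L x) \<longleftrightarrow> (\<forall>v\<in>V. 1 \<le> hom (F (Inl v)) (x v) (L x v))"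
    by (simp add: fuzzy_le_def cochains0_def qprod_def le_INF_iff)
  also have "\<dots> \<longleftrightarrow> (\<forall>v\<in>V. \<forall>w\<in>neighbors E v.
      W v w \<le> hom (F (Inl v)) (x v) (ext {v, w} v (res w {v, w} (x w))))"
    using lap x ob
    by (intro ball_cong refl weighted_meet_one_le_hom_iff) (auto simp: is_lawvere_laplacian_def)
  \<comment> \<open>Endpoints of edges lie in \<open>V\<close>, so the bound on \<open>v\<close> is
    implied by \<open>{v, w} \<in> E\<close>.\<close>
  also have "\<dots> \<longleftrightarrow> (\<forall>v w. {v, w} \<in> E \<longrightarrow>
      fuzzy_le (F (Inr {v, w})) (W v w) (res v {v, w} (x v)) (res w {v, w} (x w)))"
    using in_V by (auto simp: neighbors_def fuzzy_le_def adj)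
  finally show ?thesis .
qed

theorem theorem3p17:
  fixes V :: "'v set" and E :: "'v set set"
    and F :: "'v + 'v set \<Rightarrow> ('a, 'q::semicartesian_quantale) qcat"
    and res :: "'v \<Rightarrow> 'v set \<Rightarrow> 'a \<Rightarrow> 'a"
    and ext :: "'v set \<Rightarrow> 'v \<Rightarrow> 'a \<Rightarrow> 'a"
    and W :: "'v \<Rightarrow> 'v \<Rightarrow> 'q"
    and L :: "('v \<Rightarrow> 'a) \<Rightarrow> 'v \<Rightarrow> 'a"
  assumes "network_sheaf V E F res"
    and "network_cosheaf V E F ext"
    and "is_lawvere_laplacian V E F res ext W L"
    and "crisp E F res ext"
  shows "qcat_isomorphic (suffix_points (cochains0 V F) 1 L) (fuzzy_global_sections V E F res W)"
proof -
  interpret network_sheaf V E F res by fact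
  have "qcategory (cochains0 V F)"
    unfolding cochains0_def
    by (intro qcategory_qprod complete_weighted_lattice.axioms(1) stalk) auto
  \<comment> \<open>The two Q-categories are equal as records, so the identity functor is the
    isomorphism.\<close>
  moreover have "suffix_points (cochains0 V F) 1 L = fuzzy_global_sections V E F res W"
    unfolding suffix_points_def fuzzy_global_sections_def
  proof (rule full_sub_cong)
    fix x assume "x \<in> ob (cochains0 V F)"
    note iff = crisp_laplacian_suffix_iff[OF assms(1,3,4) this]
    show "fuzzy_le (cochains0 V F) 1 x (L x) \<longleftrightarrow>
      (\<forall>e\<in>E. \<forall>v w. e = {v, w} \<longrightarrow>
        fuzzy_le (F (Inr e)) (W v w) (res v e (x v)) (res w e (x w)) \<and>
        fuzzy_le (F (Inr e)) (W w v) (res w e (x w)) (res v e (x v)))"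
      unfolding iff
    proof (intro iffI ballI allI impI conjI; (elim conjE)?)
      fix e v w
      assume le: "\<forall>v w. {v, w} \<in> E \<longrightarrow>
          fuzzy_le (F (Inr {v, w})) (W v w) (res v {v, w} (x v)) (res w {v, w} (x w))"
        and e: "e \<in> E" "e = {v, w}"
      show "fuzzy_le (F (Inr e)) (W v w) (res v e (x v)) (res w e (x w))"
        using le[rule_format, of v w] e by simp
      \<comment> \<open>The second inequality is the first one for the swapped pair, read in the
        same edge stalk.\<close>
      have "e = {w, v}"
        using e by (simp add: insert_commute)
      then show "fuzzy_le (F (Inr e)) (W w v) (res w e (x w)) (res v e (x v))"
        using le[rule_format, of w v] e(1) by simp
    qed simp
  qed
  ultimately show ?thesis
    by (simp add: fuzzy_global_sections_def qcat_isomorphic_refl qcategory_full_sub)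
qed

end
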